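(* Let $n,p$ be arbitrary positive integers with $n>p$. Then $$\sqrt{\frac{2}{\pi}}\cdot\frac{n}{\sqrt{p+1}}\;<\;\mathcal{E}_{n,p}\;<\;\frac{\sqrt{5}}{2}\cdot\frac{n}{\sqrt{p}}.$$
   Context: $S^{p-1}=\{v\in\mathbb{R}^p:\|v\|=1\}$ with the Euclidean norm. For $\underline{u}=(u_1,\dots,u_n)\in(S^{p-1})^n$ the energy is $E_{n,p}(\underline{u})=\max_{v\in S^{p-1}}\sum_{i=1}^n|u_i\cdot v|$, and the minimal energy is $\mathcal{E}_{n,p}=\min_{\underline{u}\in(S^{p-1})^n}E_{n,p}(\underline{u})$. *)

theory Defs
  imports "HOL-Analysis.Analysis"
begin

text \<open>
  \<open>\<real>\<^sup>p\<close> is \<open>real ^ 'p\<close> with \<open>p = CARD('p)\<close>, and \<open>S\<^sup>p\<^sup>-\<^sup>1\<close> is \<open>sphere 0 1\<close> in it.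
  An \<open>n\<close>-tuple of points is an extensional function on \<open>{1..n}\<close>.
\<close>

definition energy :: "nat \<Rightarrow> (nat \<Rightarrow> real ^ 'p) \<Rightarrow> real" where
  "energy n u = (SUP v \<in> sphere 0 1. \<Sum>i = 1..n. \<bar>u i \<bullet> v\<bar>)"

definition configs :: "nat \<Rightarrow> (nat \<Rightarrow> real ^ 'p) set" where
  "configs n = (\<Pi>\<^sub>E i\<in>{1..n}. sphere 0 1)"

text \<open>The type argument carries the dimension.\<close>

definition min_energy :: "'p::finite itself \<Rightarrow> nat \<Rightarrow> real" where
  "min_energy _ n = (INF u \<in> (configs n :: (nat \<Rightarrow> real ^ 'p) set). energy n u)"

text \<open>Both extrema are attained, so the supremum and infimum above are a maximum and a minimum.\<close>

lemma sphere_ne: "sphere (0 :: real ^ 'p) 1 \<noteq> {}"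
  by simp

lemma energy_attained:
  fixes u :: "nat \<Rightarrow> real ^ 'p"
  obtains v where "v \<in> sphere 0 1" "energy n u = (\<Sum>i = 1..n. \<bar>u i \<bullet> v\<bar>)"
    "\<And>w. w \<in> sphere 0 1 \<Longrightarrow> (\<Sum>i = 1..n. \<bar>u i \<bullet> w\<bar>) \<le> energy n u"
proof -
  let ?f = "\<lambda>v. \<Sum>i = 1..n. \<bar>u i \<bullet> v\<bar>"
  have "continuous_on (sphere 0 1) ?f"
    by (intro continuous_intros)
  then obtain v where v: "v \<in> sphere 0 1" "\<And>w. w \<in> sphere 0 1 \<Longrightarrow> ?f w \<le> ?f v"
    using continuous_attains_sup[OF compact_sphere sphere_ne] by metis
  have "energy n u = ?f v"
    unfolding energy_def using v by (intro cSup_eq_maximum) auto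
  with v that show ?thesis by metis
qed

lemma energy_diff_le:
  fixes u w :: "nat \<Rightarrow> real ^ 'p"
  shows "energy n u \<le> energy n w + (\<Sum>i = 1..n. norm (u i - w i))"
proof -
  obtain v where v: "v \<in> sphere 0 1" "energy n u = (\<Sum>i = 1..n. \<bar>u i \<bullet> v\<bar>)"
    using energy_attained[of n u] by metis
  have "\<bar>u i \<bullet> v\<bar> \<le> \<bar>w i \<bullet> v\<bar> + norm (u i - w i)" for i
    using v(1) Cauchy_Schwarz_ineq2[of "u i - w i" v] by (simp add: inner_diff_left)
  then have "(\<Sum>i = 1..n. \<bar>u i \<bullet> v\<bar>) \<le> (\<Sum>i = 1..n. \<bar>w i \<bullet> v\<bar> + norm (u i - w i))"
    by (intro sum_mono)
  moreover have "(\<Sum>i = 1..n. \<bar>w i \<bullet> v\<bar>) \<le> energy n w"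
    using energy_attained[of n w] v(1) by metis
  ultimately show ?thesis
    using v(2) by (simp add: sum.distrib)
qed

lemma continuous_on_energy: "continuous_on A (energy n :: (nat \<Rightarrow> real ^ 'p) \<Rightarrow> real)"
proof (unfold continuous_on_def, intro ballI)
  fix w :: "nat \<Rightarrow> real ^ 'p"
  have "continuous_on UNIV (\<lambda>u :: nat \<Rightarrow> real ^ 'p. \<Sum>i = 1..n. norm (u i - w i))"
    by (intro continuous_intros continuous_on_product_coordinates)
  then have "((\<lambda>u. \<Sum>i = 1..n. norm (u i - w i)) \<longlongrightarrow> (\<Sum>i = 1..n. norm (w i - w i))) (at w)"
    unfolding continuous_on_def by (rule bspec) simp
  then have lim: "((\<lambda>u. \<Sum>i = 1..n. norm (u i - w i)) \<longlongrightarrow> 0) (at w within A)"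
    by (auto intro: tendsto_within_subset)
  have "norm (energy n u - energy n w) \<le> (\<Sum>i = 1..n. norm (u i - w i))" for u
    using energy_diff_le[of n u w] energy_diff_le[of n w u] by (simp add: norm_minus_commute)
  then have "((\<lambda>u. energy n u - energy n w) \<longlongrightarrow> 0) (at w within A)"
    by (intro Lim_null_comparison[OF _ lim]) auto
  then show "(energy n \<longlongrightarrow> energy n w) (at w within A)"
    by (simp add: LIM_zero_iff)
qed

lemma compact_configs: "compact (configs n :: (nat \<Rightarrow> real ^ 'p) set)"
proof -
  have eq: "(configs n :: (nat \<Rightarrow> real ^ 'p) set)
      = (\<Pi>\<^sub>E i\<in>UNIV. if i \<in> {1..n} then sphere 0 1 else {undefined})"
    by (fastforce simp: configs_def PiE_def Pi_def extensional_def split: if_splits)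
  have "compactin (product_topology (\<lambda>_. euclidean) UNIV) (configs n :: (nat \<Rightarrow> real ^ 'p) set)"
    unfolding eq compactin_PiE by auto
  then show ?thesis
    by (simp add: euclidean_product_topology)
qed

lemma configs_ne: "(configs n :: (nat \<Rightarrow> real ^ 'p) set) \<noteq> {}"
  unfolding configs_def by (simp add: PiE_eq_empty_iff)

lemma min_energy_attained:
  obtains u :: "nat \<Rightarrow> real ^ 'p" where "u \<in> configs n" "min_energy TYPE('p) n = energy n u"
    "\<And>w :: nat \<Rightarrow> real ^ 'p. w \<in> configs n \<Longrightarrow> min_energy TYPE('p) n \<le> energy n w"
proof -
  have "\<exists>u \<in> (configs n :: (nat \<Rightarrow> real ^ 'p) set).
      \<forall>w \<in> (configs n :: (nat \<Rightarrow> real ^ 'p) set). energy n u \<le> energy n w"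
    by (rule continuous_attains_inf[OF compact_configs configs_ne continuous_on_energy])
  then obtain u :: "nat \<Rightarrow> real ^ 'p" where u: "u \<in> configs n"
      "\<And>w :: nat \<Rightarrow> real ^ 'p. w \<in> configs n \<Longrightarrow> energy n u \<le> energy n w"
    by blast
  have "min_energy TYPE('p) n = energy n u"
    unfolding min_energy_def using u by (intro cInf_eq_minimum) auto
  with u that show ?thesis by metis
qed

end

theory Submission
  imports Defs "HOL-Probability.Distributions"
begin

text \<open>
  Lower bound. The energy dominates every average of \<open>\<Sum>\<^sub>i \<bar>u\<^sub>i \<bullet> v\<bar>\<close> over directions
  \<open>v\<close>. Averaging is easiest with a standard Gaussian vector \<open>g\<close> in place of a uniform
  point of the sphere. By homogeneity \<open>\<Sum>\<^sub>i \<bar>u\<^sub>i \<bullet> g\<bar> \<le> E(u) \<parallel>g\<parallel>\<close>. Each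
  \<open>u\<^sub>i \<bullet> g\<close> is a standard normal variable, so the left-hand side has mean
  \<open>n \<surd>(2/\<pi>)\<close>, whereas \<open>\<parallel>g\<parallel>\<close> has mean at most \<open>\<surd>p\<close> because
  \<open>\<parallel>g\<parallel>\<^sup>2\<close> has mean \<open>p\<close>. Hence \<open>E(u) \<ge> \<surd>(2/\<pi>) n / \<surd>p\<close>, which is slightly
  more than what is claimed and makes the inequality strict.

  Upper bound. Run cyclically through the vectors of an orthonormal basis, so that the
  \<open>j\<close>-th one occurs \<open>c\<^sub>j \<in> {k, k + 1}\<close> times, where \<open>k = n div p \<ge> 1\<close>. By
  Cauchy-Schwarz \<open>\<Sum>\<^sub>j c\<^sub>j \<bar>v\<^sub>j\<bar> \<le> \<surd>(\<Sum>\<^sub>j c\<^sub>j\<^sup>2)\<close> on the sphere, and the two possible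
  values of \<open>c\<^sub>j\<close> together with \<open>\<Sum>\<^sub>j c\<^sub>j = n\<close> determine \<open>\<Sum>\<^sub>j c\<^sub>j\<^sup>2\<close>. That this is
  below \<open>5 n\<^sup>2 / (4 p)\<close> is a quadratic inequality in \<open>n\<close> with negative discriminant.
\<close>

section \<open>Gaussian vectors\<close>

definition gaussian :: "('i \<Rightarrow> real) measure" where
  "gaussian = PiM UNIV (\<lambda>_. density lborel std_normal_density)"

lemma prob_space_gaussian: "prob_space (gaussian :: ('i \<Rightarrow> real) measure)"
  unfolding gaussian_def by (intro prob_space_PiM prob_space_normal_density) simp

lemma measurable_gaussian_coordinate [measurable]:
  "(\<lambda>g. g i) \<in> borel_measurable gaussian"
proof -
  have "(\<lambda>g. g i) \<in> measurable gaussian (density lborel std_normal_density)"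
    unfolding gaussian_def by (rule measurable_component_singleton) simp
  then show ?thesis by simp
qed

lemma distr_gaussian_coordinate:
  "distr gaussian borel (\<lambda>g. g i) = density lborel std_normal_density"
proof -
  have "distr gaussian (density lborel std_normal_density) (\<lambda>g. g i)
      = density lborel std_normal_density"
    unfolding gaussian_def
    by (rule distr_PiM_component) (auto intro: prob_space_normal_density)
  moreover have "distr gaussian borel (\<lambda>g. g i)
      = distr gaussian (density lborel std_normal_density) (\<lambda>g. g i)"
    by (intro distr_cong) auto
  ultimately show ?thesis by simp
qed

lemma gaussian_coordinate_std_normal:
  "distributed gaussian lborel (\<lambda>g. g i) std_normal_density"
proof -
  have "distr gaussian lborel (\<lambda>g. g i) = distr gaussian borel (\<lambda>g. g i)"
    by (intro distr_cong) auto
  then show ?thesis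
    using distr_gaussian_coordinate[of i] unfolding distributed_def by auto
qed

lemma indep_vars_gaussian_coordinates:
  "prob_space.indep_vars gaussian (\<lambda>_. borel) (\<lambda>i g. g i) (UNIV :: 'i set)"
proof -
  interpret prob_space "gaussian :: ('i \<Rightarrow> real) measure"
    by (rule prob_space_gaussian)
  have "distr gaussian (\<Pi>\<^sub>M i\<in>(UNIV :: 'i set). borel) (\<lambda>g. g) = distr gaussian gaussian (\<lambda>g. g)"
    unfolding gaussian_def by (intro distr_cong) (auto cong: sets_PiM_cong)
  also have "\<dots> = (\<Pi>\<^sub>M i\<in>(UNIV :: 'i set). distr gaussian borel (\<lambda>g. g i))"
    unfolding distr_gaussian_coordinate by (simp add: gaussian_def)
  finally show ?thesis
    by (subst indep_vars_iff_distr_eq_PiM) (auto simp: restrict_UNIV)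
qed

text \<open>
  This is the rotation invariance of the Gaussian measure in the only form needed: the
  projection to any direction has the same law.
\<close>

lemma gaussian_projection_std_normal:
  fixes w :: "real ^ 'i"
  assumes "norm w = 1"
  shows "distributed gaussian lborel (\<lambda>g. \<Sum>i\<in>UNIV. w $ i * g i) std_normal_density"
proof -
  interpret prob_space "gaussian :: ('i \<Rightarrow> real) measure"
    by (rule prob_space_gaussian)
  \<comment> \<open>A zero coefficient would give a degenerate normal summand, so those terms are dropped.\<close>
  define I where "I = {i. w $ i \<noteq> 0}"
  have "I \<noteq> {}"
  proof
    assume "I = {}"
    then have "w = 0"
      by (simp add: I_def vec_eq_iff)
    with assms show False by simp
  qed
  have indep: "indep_vars (\<lambda>_. borel) (\<lambda>i g. w $ i * g i) I"
    using indep_vars_compose2[OF indep_vars_gaussian_coordinates, of "\<lambda>i x. w $ i * x" "\<lambda>_. borel"]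
    by (rule indep_vars_subset) auto
  have normal: "distributed gaussian lborel (\<lambda>g. w $ i * g i) (normal_density 0 \<bar>w $ i\<bar>)"
    if "i \<in> I" for i
    using normal_density_affine[OF gaussian_coordinate_std_normal[of i], of "w $ i" 0] that
    by (simp add: I_def)
  have "distributed gaussian lborel (\<lambda>g. \<Sum>i\<in>I. w $ i * g i)
      (normal_density (\<Sum>i\<in>I. 0) (sqrt (\<Sum>i\<in>I. \<bar>w $ i\<bar>\<^sup>2)))"
    by (rule sum_indep_normal) (use \<open>I \<noteq> {}\<close> indep normal in \<open>auto simp: I_def\<close>)
  moreover have "(\<Sum>i\<in>I. w $ i * g i) = (\<Sum>i\<in>UNIV. w $ i * g i)" for g :: "'i \<Rightarrow> real"
    by (rule sum.mono_neutral_left) (auto simp: I_def)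
  moreover have "sqrt (\<Sum>i\<in>I. \<bar>w $ i\<bar>\<^sup>2) = norm w"
    unfolding norm_vec_def L2_set_def real_norm_def
    by (rule arg_cong[of _ _ sqrt], rule sum.mono_neutral_left) (auto simp: I_def)
  ultimately show ?thesis
    using assms by simp
qed

lemma has_bochner_integral_std_normal:
  fixes X :: "'a \<Rightarrow> real"
  assumes X: "distributed M lborel X std_normal_density"
    and f: "f \<in> borel_measurable borel"
    and int: "has_bochner_integral lborel (\<lambda>x. std_normal_density x * f x) c"
  shows "has_bochner_integral M (\<lambda>\<omega>. f (X \<omega>)) c"
  using distributed_integral[OF X, of f] distributed_integrable[OF X, of f] f int
  by (simp add: has_bochner_integral_iff)

lemma gaussian_abs_projection_mean:
  fixes w :: "real ^ 'i"
  assumes "norm w = 1"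
  shows "has_bochner_integral gaussian (\<lambda>g. \<bar>w \<bullet> (\<chi> i. g i)\<bar>) (sqrt (2 / pi))"
  using has_bochner_integral_std_normal[OF gaussian_projection_std_normal[OF assms], of abs]
    std_normal_moment_abs_odd[of 0]
  by (simp add: inner_vec_def)

lemma gaussian_norm_square_mean:
  "has_bochner_integral gaussian (\<lambda>g. (norm (\<chi> i. g i :: real ^ 'i))\<^sup>2) (real CARD('i))"
proof -
  have "has_bochner_integral gaussian (\<lambda>g. (g i)\<^sup>2) 1" for i :: 'i
    using has_bochner_integral_std_normal[OF gaussian_coordinate_std_normal, of "\<lambda>x. x\<^sup>2"]
      std_normal_moment_even[of 1]
    by (simp add: fact_numeral)
  then have "has_bochner_integral gaussian (\<lambda>g. \<Sum>i\<in>(UNIV :: 'i set). (g i)\<^sup>2) (\<Sum>i\<in>(UNIV :: 'i set). 1)"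
    by (rule has_bochner_integral_sum)
  then show ?thesis
    by (simp add: norm_vec_def L2_set_def sum_nonneg)
qed

section \<open>The lower bound by averaging\<close>

lemma sum_abs_inner_le_energy_norm:
  fixes u :: "nat \<Rightarrow> real ^ 'p"
  shows "(\<Sum>i = 1..n. \<bar>u i \<bullet> x\<bar>) \<le> energy n u * norm x"
proof (cases "x = 0")
  case False
  have "(\<Sum>i = 1..n. \<bar>u i \<bullet> (x /\<^sub>R norm x)\<bar>) \<le> energy n u"
    using energy_attained[of n u] False by (metis norm_sgn sgn_div_norm mem_sphere_0)
  then show ?thesis
    using False
    by (simp add: abs_mult inverse_eq_divide sum_divide_distrib[symmetric] pos_divide_le_eq)
qed simp

text \<open>
  The bound \<open>2 \<surd>p \<parallel>g\<parallel> \<le> \<parallel>g\<parallel>\<^sup>2 + p\<close> replaces Jensen's inequality for the mean of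
  \<open>\<parallel>g\<parallel>\<close>: its right-hand side has mean \<open>2 p\<close>.
\<close>

lemma energy_lower_bound:
  fixes u :: "nat \<Rightarrow> real ^ 'p"
  assumes u: "u \<in> configs n"
  shows "sqrt (2 / pi) * real n \<le> energy n u * sqrt (real CARD('p))"
proof -
  interpret prob_space "gaussian :: ('p \<Rightarrow> real) measure"
    by (rule prob_space_gaussian)
  define s where "s = sqrt (real CARD('p))"
  have s: "s > 0" "s\<^sup>2 = real CARD('p)"
    by (simp_all add: s_def)
  have E: "0 \<le> energy n u"
    using energy_attained[of n u] by (metis abs_ge_zero sum_nonneg)
  have "has_bochner_integral gaussian (\<lambda>g. \<bar>u i \<bullet> (\<chi> j. g j)\<bar>) (sqrt (2 / pi))" if "i \<in> {1..n}" for i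
    using u that by (intro gaussian_abs_projection_mean) (auto simp: configs_def PiE_def Pi_def)
  then have "has_bochner_integral gaussian (\<lambda>g. \<Sum>i = 1..n. \<bar>u i \<bullet> (\<chi> j. g j)\<bar>) (\<Sum>i = 1..n. sqrt (2 / pi))"
    by (rule has_bochner_integral_sum)
  then have lhs: "has_bochner_integral gaussian
      (\<lambda>g. 2 * s * (\<Sum>i = 1..n. \<bar>u i \<bullet> (\<chi> j. g j)\<bar>)) (2 * s * (real n * sqrt (2 / pi)))"
    by (intro has_bochner_integral_mult_right) simp
  have rhs: "has_bochner_integral gaussian (\<lambda>g. energy n u * ((norm (\<chi> j. g j :: real ^ 'p))\<^sup>2 + s\<^sup>2))
      (energy n u * (real CARD('p) + s\<^sup>2))"
    using has_bochner_integral_add[OF gaussian_norm_square_mean[where 'i = 'p], of "\<lambda>_. s\<^sup>2" "s\<^sup>2"]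
    by (intro has_bochner_integral_mult_right)
      (auto simp: has_bochner_integral_iff prob_space)
  have pointwise: "2 * s * (\<Sum>i = 1..n. \<bar>u i \<bullet> x\<bar>) \<le> energy n u * ((norm x)\<^sup>2 + s\<^sup>2)"
    for x :: "real ^ 'p"
  proof -
    have "2 * s * (\<Sum>i = 1..n. \<bar>u i \<bullet> x\<bar>) \<le> 2 * s * (energy n u * norm x)"
      using s(1) sum_abs_inner_le_energy_norm by (intro mult_left_mono) auto
    also have "\<dots> = energy n u * (2 * s * norm x)"
      by simp
    also have "\<dots> \<le> energy n u * ((norm x)\<^sup>2 + s\<^sup>2)"
      using E sum_squares_bound[of s "norm x"] by (intro mult_left_mono) auto
    finally show ?thesis .
  qed
  have "2 * s * (real n * sqrt (2 / pi)) \<le> energy n u * (real CARD('p) + s\<^sup>2)"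
    unfolding has_bochner_integral_integral_eq[OF lhs, symmetric]
      has_bochner_integral_integral_eq[OF rhs, symmetric]
    by (rule integral_mono[OF integrable.intros[OF lhs] integrable.intros[OF rhs] pointwise])
  also have "\<dots> = 2 * s * (energy n u * s)"
    using s(2) by (simp add: power2_eq_square)
  finally have "real n * sqrt (2 / pi) \<le> energy n u * s"
    using s(1) by simp
  then show ?thesis
    by (simp add: s_def mult.commute)
qed

section \<open>The upper bound from a repeated orthonormal basis\<close>

lemma card_residue_class_bounds:
  fixes n p j :: nat
  assumes "j < p"
  shows "card {i. i < n \<and> i mod p = j} \<in> {n div p, n div p + 1}"
proof -
  define Q where "Q = {q. q * p + j < n}"
  have "{i. i < n \<and> i mod p = j} = (\<lambda>q. q * p + j) ` Q"
  proof (intro set_eqI iffI)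
    fix i assume "i \<in> {i. i < n \<and> i mod p = j}"
    then show "i \<in> (\<lambda>q. q * p + j) ` Q"
      unfolding Q_def using div_mult_mod_eq[of i p] by (intro image_eqI[of _ _ "i div p"]) auto
  qed (use assms in \<open>auto simp: Q_def\<close>)
  then have card_eq: "card {i. i < n \<and> i mod p = j} = card Q"
    using assms by (auto intro!: card_image inj_onI)
  have lo: "{..<n div p} \<subseteq> Q"
  proof
    fix q assume "q \<in> {..<n div p}"
    then have "Suc q * p \<le> n div p * p"
      by (intro mult_le_mono1) auto
    also have "n div p * p \<le> n"
      by (rule div_times_less_eq_dividend)
    finally show "q \<in> Q"
      using assms by (simp add: Q_def)
  qed
  have hi: "Q \<subseteq> {..<n div p + 1}"
    using assms by (auto simp: Q_def less_eq_div_iff_mult_less_eq less_Suc_eq_le)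
  show ?thesis
    using card_mono[OF _ hi] card_mono[OF finite_subset[OF hi] lo] card_eq by auto
qed

text \<open>
  A bijection between the index type and an initial segment of the naturals turns the residue
  classes of the indices into an almost equidistributed labelling.
\<close>

lemma balanced_labelling_exists:
  fixes n :: nat
  shows "\<exists>b :: nat \<Rightarrow> 'p::finite. \<forall>j. card {i \<in> {1..n}. b i = j} \<in> {n div CARD('p), n div CARD('p) + 1}"
proof -
  obtain h :: "nat \<Rightarrow> 'p" where h: "bij_betw h {0..<CARD('p)} UNIV"
    using ex_bij_betw_nat_finite[of "UNIV :: 'p set"] by auto
  define b where "b i = h ((i - 1) mod CARD('p))" for i
  have "card {i \<in> {1..n}. b i = j} \<in> {n div CARD('p), n div CARD('p) + 1}" for j
  proof -
    obtain r where r: "r < CARD('p)" "h r = j"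
      using h unfolding bij_betw_def by (metis UNIV_I atLeastLessThan_iff imageE)
    have "h (i mod CARD('p)) = j \<longleftrightarrow> i mod CARD('p) = r" for i
      using bij_betw_imp_inj_on[OF h] r by (auto simp: inj_on_def)
    then have "{i \<in> {1..n}. b i = j} = Suc ` {i. i < n \<and> i mod CARD('p) = r}"
      by (force simp: b_def image_iff gr0_conv_Suc Suc_le_eq)
    then have "card {i \<in> {1..n}. b i = j} = card {i. i < n \<and> i mod CARD('p) = r}"
      by (simp add: card_image)
    then show ?thesis
      using card_residue_class_bounds[OF r(1), of n] by simp
  qed
  then show ?thesis by blast
qed

lemma sum_abs_inner_axes_le:
  fixes v :: "real ^ 'p" and b :: "nat \<Rightarrow> 'p"
  assumes "finite A"
  shows "(\<Sum>i\<in>A. \<bar>axis (b i) 1 \<bullet> v\<bar>)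
    \<le> sqrt (\<Sum>j\<in>UNIV. (real (card {i \<in> A. b i = j}))\<^sup>2) * norm v"
proof -
  have "(\<Sum>i\<in>A. \<bar>axis (b i) 1 \<bullet> v\<bar>) = (\<Sum>i\<in>A. \<bar>v $ b i\<bar>)"
    by (simp add: inner_axis')
  also have "\<dots> = (\<Sum>j\<in>UNIV. \<Sum>i\<in>{i \<in> A. b i = j}. \<bar>v $ b i\<bar>)"
    by (rule sum.group[symmetric]) (use assms in auto)
  also have "\<dots> = (\<Sum>j\<in>UNIV. \<bar>real (card {i \<in> A. b i = j})\<bar> * \<bar>v $ j\<bar>)"
    by simp
  also have "\<dots> \<le> L2_set (\<lambda>j. real (card {i \<in> A. b i = j})) UNIV * L2_set (\<lambda>j. v $ j) UNIV"
    by (rule L2_set_mult_ineq)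
  also have "L2_set (\<lambda>j. v $ j) UNIV = norm v"
    by (simp add: norm_vec_def L2_set_def)
  finally show ?thesis
    by (simp add: L2_set_def)
qed

text \<open>
  If \<open>c\<^sub>j \<in> {k, k + 1}\<close> then \<open>(c\<^sub>j - k) (c\<^sub>j - k - 1) = 0\<close>, so \<open>c\<^sub>j\<^sup>2\<close> is an affine function of
  \<open>c\<^sub>j\<close> and the sum of the squares depends only on the sum.
\<close>

lemma sum_squares_balanced:
  fixes c :: "'p::finite \<Rightarrow> nat"
  assumes "\<And>j. c j \<in> {k, k + 1}"
  shows "(\<Sum>j\<in>UNIV. (real (c j))\<^sup>2)
    = (2 * real k + 1) * real (\<Sum>j\<in>UNIV. c j) - real CARD('p) * (real k * (real k + 1))"
proof -
  have "(real (c j))\<^sup>2 = (2 * real k + 1) * real (c j) - real k * (real k + 1)" for j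
    using assms[of j] by (auto simp: power2_eq_square algebra_simps)
  then show ?thesis
    by (simp add: sum_subtractf sum_distrib_left)
qed

lemma balanced_quadratic_bound:
  fixes k n p :: real
  assumes "k \<ge> 1" "p > 0"
  shows "4 * p * ((2 * k + 1) * n - p * (k * (k + 1))) < 5 * n\<^sup>2"
proof -
  \<comment> \<open>Completing the square in \<open>n\<close> leaves a remainder with the sign of \<open>k\<^sup>2 + k - 1\<close>.\<close>
  have "5 * n\<^sup>2 - 4 * p * ((2 * k + 1) * n - p * (k * (k + 1)))
      = 5 * (n - 2 / 5 * (2 * k + 1) * p)\<^sup>2 + 4 / 5 * p\<^sup>2 * (k * k + (k - 1))"
    by (simp add: power2_eq_square field_simps)
  moreover have "k * k + (k - 1) > 0"
    using assms by (intro add_pos_nonneg mult_pos_pos) auto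
  then have "4 / 5 * p\<^sup>2 * (k * k + (k - 1)) > 0"
    using assms by simp
  ultimately show ?thesis
    by (smt (verit) zero_le_power2)
qed

lemma low_energy_config_exists:
  assumes "n \<ge> CARD('p)"
  shows "\<exists>u \<in> (configs n :: (nat \<Rightarrow> real ^ 'p) set).
    energy n u < sqrt 5 / 2 * (real n / sqrt (real CARD('p)))"
proof -
  define k where "k = n div CARD('p)"
  have k: "k \<ge> 1"
    using div_le_mono[OF assms, of "CARD('p)"] by (simp add: k_def)
  obtain b :: "nat \<Rightarrow> 'p" where b: "\<And>j. card {i \<in> {1..n}. b i = j} \<in> {k, k + 1}"
    using balanced_labelling_exists[of n] unfolding k_def by blast
  define u :: "nat \<Rightarrow> real ^ 'p" where "u = (\<lambda>i\<in>{1..n}. axis (b i) 1)"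
  define S where "S = (\<Sum>j\<in>UNIV. (real (card {i \<in> {1..n}. b i = j}))\<^sup>2)"
  have "u \<in> configs n"
    by (auto simp: u_def configs_def)
  moreover have "energy n u \<le> sqrt S"
  proof -
    obtain v where v: "norm v = 1" "energy n u = (\<Sum>i = 1..n. \<bar>u i \<bullet> v\<bar>)"
      using energy_attained[of n u] by auto
    then show ?thesis
      using sum_abs_inner_axes_le[where A = "{1..n}" and b = b and v = v] by (simp add: S_def u_def)
  qed
  moreover have "sqrt S < sqrt 5 / 2 * (real n / sqrt (real CARD('p)))"
  proof -
    have "(\<Sum>j\<in>UNIV. card {i \<in> {1..n}. b i = j}) = n"
      using sum.group[of "{1..n}" UNIV b "\<lambda>_. 1 :: nat"] by simp
    then have "S = (2 * real k + 1) * real n - real CARD('p) * (real k * (real k + 1))"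
      unfolding S_def
      by (simp only: sum_squares_balanced[of "\<lambda>j. card {i \<in> {1..n}. b i = j}", OF b])
    then have "4 * real CARD('p) * S < 5 * (real n)\<^sup>2"
      using balanced_quadratic_bound[of "real k" "real CARD('p)" "real n"] k by simp
    then have "S < 5 / 4 * ((real n)\<^sup>2 / real CARD('p))"
      by (simp add: field_simps)
    then have "sqrt S < sqrt (5 / 4 * ((real n)\<^sup>2 / real CARD('p)))"
      by simp
    then show ?thesis
      by (simp add: real_sqrt_mult real_sqrt_divide)
  qed
  ultimately show ?thesis by force
qed

section \<open>Both bounds\<close>

theorem theorem3p4:
  fixes n p :: nat
  assumes "p = CARD('p::finite)" and "n > p"
  shows "sqrt (2 / pi) * (real n / sqrt (real p + 1)) < min_energy TYPE('p) n
       \<and> min_energy TYPE('p) n < sqrt 5 / 2 * (real n / sqrt (real p))"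
proof
  obtain u :: "nat \<Rightarrow> real ^ 'p" where u: "u \<in> configs n" "min_energy TYPE('p) n = energy n u"
    and min: "\<And>w :: nat \<Rightarrow> real ^ 'p. w \<in> configs n \<Longrightarrow> min_energy TYPE('p) n \<le> energy n w"
    by (rule min_energy_attained[where 'p = 'p and n = n]) blast
  have p: "p > 0"
    using assms(1) by simp
  have "real n / sqrt (real p + 1) < real n / sqrt (real p)"
    using p assms(2) by (intro divide_strict_left_mono) auto
  then have "sqrt (2 / pi) * (real n / sqrt (real p + 1)) < sqrt (2 / pi) * (real n / sqrt (real p))"
    by (intro mult_strict_left_mono) auto
  also have "\<dots> \<le> energy n u"
    using energy_lower_bound[OF u(1)] p assms(1) by (simp add: field_simps)
  finally show "sqrt (2 / pi) * (real n / sqrt (real p + 1)) < min_energy TYPE('p) n"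
    using u(2) by simp
  show "min_energy TYPE('p) n < sqrt 5 / 2 * (real n / sqrt (real p))"
    using low_energy_config_exists[where 'p = 'p and n = n] min assms by force
qed

end
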